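(* Let $U\subset\mathbb{R}^2$ be an open subset, $X:U\to\mathbb{R}^4_2$ an immersion whose image $M=X(U)$ is a Lorentzian surface, with adapted frame $\{e_1,e_2,e_3,e_4\}$, and let $LG_M^{\pm}:U\to S_t^1\times S_s^1$, $LG_M^{\pm}(x,y)=\widetilde{e_1\pm e_2}(x,y)$, be its $S_t^1\times S_s^1$-valued lightcone Gauss maps. (1) $LG_M^{+}$ (respectively, $LG_M^{-}$) is constant if and only if there exists a unique lightlike hyperplane $LHP(v^+,c^+)$ (respectively, $LHP(v^-,c^-)$) such that $M\subset LHP(v^+,c^+)$ (respectively, $M\subset LHP(v^-,c^-)$), where $v^{\pm}=\widetilde{e_1\pm e_2}(x,y)$ and $\langle X(x,y),v^{\pm}\rangle=c^{\pm}$ for any $(x,y)\in M$. (2) Both of the lightcone Gauss maps $LG_M^{+}$ and $LG_M^{-}$ are constant if and only if $M$ is a Lorentzian 2-plane. In this case, the intersection of lightlike hyperplanes $$LHP(\widetilde{e_1+e_2},c^+)\cap LHP(\widetilde{e_1-e_2},c^-)$$ is the Lorentzian 2-plane $M$.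
   Context: All maps are $C^\infty$. $\mathbb{R}^4_2$ denotes $\mathbb{R}^4$ with the pseudo scalar product $\langle x,y\rangle=-x_1y_1-x_2y_2+x_3y_3+x_4y_4$. A nonzero vector $x$ is spacelike, lightlike or timelike if $\langle x,x\rangle>0$, $=0$, $<0$ respectively. For a lightlike vector $n$ and $c\in\mathbb{R}$, the lightlike hyperplane with pseudo normal $n$ is $LHP(n,c)=\{x\in\mathbb{R}^4_2:\langle x,n\rangle=c\}$. $M=X(U)$ is identified with $U$ via $X$. It is a Lorentzian surface if at each $p\in M$ the tangent plane $T_pM$ is a Lorentzian plane ($\langle\,,\rangle$ restricted to it has signature $(1,1)$); then the normal plane $N_pM$ is Lorentzian too. A Lorentzian 2-plane in $\mathbb{R}^4_2$ is an affine 2-plane whose direction space is a Lorentzian plane. An adapted frame is a smooth frame $e_1,e_2,e_3,e_4$ along $U$ of mutually orthogonal vectors with $e_3,e_4$ spanning $T_pM$, $e_1,e_2$ spanning $N_pM$, $\langle e_1,e_1\rangle=\langle e_3,e_3\rangle=-1$, $\langle e_2,e_2\rangle=\langle e_4,e_4\rangle=1$. $LC_0=\{x\in\mathbb{R}^4_2: -x_1^2-x_2^2+x_3^2+x_4^2=0\}$ and $S_t^1\times S_s^1=\{x\in LC_0: x_1^2+x_2^2=1,\ x_1\ge0,\ x_2\ge0\}$. For a lightlike vector $x$, put $\widetilde{x}=x/\sqrt{x_1^2+x_2^2}$, regarded as an element of $S_t^1\times S_s^1$; $\widetilde{e_1\pm e_2}(x,y)$ is this normalization of $e_1(x,y)\pm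 e_2(x,y)$.
   Formalization: U is assumed connected and nonempty (the claim fails for two discs mapped to parallel planes), and "M is a Lorentzian 2-plane" is read as "M is a relatively open subset of a Lorentzian 2-plane P", with the intersection of the hyperplanes equal to P. *)

theory Defs
  imports "HOL-Analysis.Analysis"
begin

text \<open>
  Smoothness on an open set: differentiate in an arbitrary constant direction \<open>v\<close>, any number
  of times. The definition is only meant for open \<open>U\<close>, since it uses derivatives at the points
  of \<open>U\<close> that are not relative to \<open>U\<close>.
\<close>

fun Ck_on :: "nat \<Rightarrow> 'a::real_normed_vector set \<Rightarrow> ('a \<Rightarrow> 'b::real_normed_vector) \<Rightarrow> bool" where
  "Ck_on 0 U f \<longleftrightarrow> continuous_on U f"
| "Ck_on (Suc k) U f \<longleftrightarrow>
     (\<forall>p\<in>U. f differentiable (at p)) \<and> (\<forall>v. Ck_on k U (\<lambda>p. frechet_derivative f (at p) v))"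

definition smooth_on :: "'a::real_normed_vector set \<Rightarrow> ('a \<Rightarrow> 'b::real_normed_vector) \<Rightarrow> bool" where
  "smooth_on U f \<longleftrightarrow> (\<forall>k. Ck_on k U f)"

definition immersion_on :: "'a::real_normed_vector set \<Rightarrow> ('a \<Rightarrow> 'b::real_normed_vector) \<Rightarrow> bool" where
  "immersion_on U X \<longleftrightarrow> smooth_on U X \<and> (\<forall>p\<in>U. inj (frechet_derivative X (at p)))"

definition psp :: "real^4 \<Rightarrow> real^4 \<Rightarrow> real" where
  "psp x y = - x$1 * y$1 - x$2 * y$2 + x$3 * y$3 + x$4 * y$4"

definition lightlike :: "real^4 \<Rightarrow> bool" where
  "lightlike x \<longleftrightarrow> x \<noteq> 0 \<and> psp x x = 0"

definition LHP :: "real^4 \<Rightarrow> real \<Rightarrow> (real^4) set" where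
  "LHP n c = {x. psp x n = c}"

text \<open>The last conjunct says that \<open>psp\<close> has signature (1,1) on the 2-dimensional space \<open>V\<close>.\<close>

definition lorentzian_plane :: "(real^4) set \<Rightarrow> bool" where
  "lorentzian_plane V \<longleftrightarrow> subspace V \<and> dim V = 2 \<and>
     (\<exists>u\<in>V. \<exists>w\<in>V. psp u w = 0 \<and> psp u u < 0 \<and> psp w w > 0)"

definition lorentzian_2plane :: "(real^4) set \<Rightarrow> bool" where
  "lorentzian_2plane P \<longleftrightarrow> (\<exists>a V. lorentzian_plane V \<and> P = (\<lambda>v. a + v) ` V)"

text \<open>
  Since \<open>X\<close> need not be injective, tangent and normal planes are attached to parameters \<open>p \<in> U\<close>
  rather than to points of the image.
\<close>

definition tangent_plane :: "(real^2 \<Rightarrow> real^4) \<Rightarrow> real^2 \<Rightarrow> (real^4) set" where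
  "tangent_plane X p = range (frechet_derivative X (at p))"

definition normal_plane :: "(real^2 \<Rightarrow> real^4) \<Rightarrow> real^2 \<Rightarrow> (real^4) set" where
  "normal_plane X p = {n. \<forall>t\<in>tangent_plane X p. psp n t = 0}"

definition lorentzian_surface :: "(real^2) set \<Rightarrow> (real^2 \<Rightarrow> real^4) \<Rightarrow> bool" where
  "lorentzian_surface U X \<longleftrightarrow> immersion_on U X \<and> (\<forall>p\<in>U. lorentzian_plane (tangent_plane X p))"

definition adapted_frame ::
  "(real^2) set \<Rightarrow> (real^2 \<Rightarrow> real^4) \<Rightarrow> (real^2 \<Rightarrow> real^4) \<Rightarrow> (real^2 \<Rightarrow> real^4)
     \<Rightarrow> (real^2 \<Rightarrow> real^4) \<Rightarrow> (real^2 \<Rightarrow> real^4) \<Rightarrow> bool" where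
  "adapted_frame U X e1 e2 e3 e4 \<longleftrightarrow>
     smooth_on U e1 \<and> smooth_on U e2 \<and> smooth_on U e3 \<and> smooth_on U e4 \<and>
     (\<forall>p\<in>U.
        psp (e1 p) (e2 p) = 0 \<and> psp (e1 p) (e3 p) = 0 \<and> psp (e1 p) (e4 p) = 0 \<and>
        psp (e2 p) (e3 p) = 0 \<and> psp (e2 p) (e4 p) = 0 \<and> psp (e3 p) (e4 p) = 0 \<and>
        psp (e1 p) (e1 p) = -1 \<and> psp (e3 p) (e3 p) = -1 \<and>
        psp (e2 p) (e2 p) = 1 \<and> psp (e4 p) (e4 p) = 1 \<and>
        span {e3 p, e4 p} = tangent_plane X p \<and>
        span {e1 p, e2 p} = normal_plane X p)"

definition lc_normalize :: "real^4 \<Rightarrow> real^4" where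
  "lc_normalize x = x /\<^sub>R sqrt ((x$1)\<^sup>2 + (x$2)\<^sup>2)"

text \<open>
  The full torus, with no sign restriction on the first two coordinates: normalization divides
  by a positive number and so keeps their signs.
\<close>

definition St1_Ss1 :: "(real^4) set" where
  "St1_Ss1 = {x. psp x x = 0 \<and> (x$1)\<^sup>2 + (x$2)\<^sup>2 = 1}"

lemma lc_normalize_in_St1_Ss1:
  assumes "lightlike x"
  shows "lc_normalize x \<in> St1_Ss1"
proof -
  define r where "r = (x$1)\<^sup>2 + (x$2)\<^sup>2"
  have "r \<noteq> 0"
  proof
    assume r0: "r = 0"
    have a: "x$1 = 0" "x$2 = 0"
      using r0 unfolding r_def by (auto simp: sum_power2_eq_zero_iff)
    then have "(x$3)\<^sup>2 + (x$4)\<^sup>2 = 0"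
      using assms by (simp add: lightlike_def psp_def power2_eq_square)
    then have "x$3 = 0" "x$4 = 0" by (auto simp: sum_power2_eq_zero_iff)
    with a have "x = 0" by (simp add: vec_eq_iff forall_4)
    with assms show False by (simp add: lightlike_def)
  qed
  moreover have "r \<ge> 0" by (simp add: r_def)
  ultimately have r: "r > 0" by simp
  have "psp (lc_normalize x) (lc_normalize x) = psp x x / r"
    using r unfolding lc_normalize_def r_def[symmetric] psp_def
    by (simp add: field_simps flip: power2_eq_square)
  moreover have "(lc_normalize x $ 1)\<^sup>2 + (lc_normalize x $ 2)\<^sup>2 = inverse r * (x$1)\<^sup>2 + inverse r * (x$2)\<^sup>2"
    using r unfolding lc_normalize_def r_def[symmetric]
    by (simp add: power_mult_distrib power_inverse)
  then have "(lc_normalize x $ 1)\<^sup>2 + (lc_normalize x $ 2)\<^sup>2 = 1"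
    using r by (simp flip: distrib_left r_def)
  ultimately show ?thesis
    using r assms by (simp add: St1_Ss1_def lightlike_def)
qed

definition LG_plus :: "(real^2 \<Rightarrow> real^4) \<Rightarrow> (real^2 \<Rightarrow> real^4) \<Rightarrow> real^2 \<Rightarrow> real^4" where
  "LG_plus e1 e2 p = lc_normalize (e1 p + e2 p)"

definition LG_minus :: "(real^2 \<Rightarrow> real^4) \<Rightarrow> (real^2 \<Rightarrow> real^4) \<Rightarrow> real^2 \<Rightarrow> real^4" where
  "LG_minus e1 e2 p = lc_normalize (e1 p - e2 p)"

end

theory Submission
  imports Defs
begin

text \<open>
  Both parts rest on one remark: for a fixed vector \<open>v\<close>, the height function
  \<open>p \<mapsto> \<langle>X p, v\<rangle>\<close> has derivative \<open>w \<mapsto> \<langle>dX w, v\<rangle>\<close>, so on a connected open set it is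
  constant exactly when \<open>v\<close> is normal to the surface at every point
  (\<open>const_on_psp_imp_normal\<close>, \<open>psp_const_if_normal\<close>).

  A constant Gauss map is such a vector \<open>v\<close>, whence the lightlike hyperplane. Conversely, if the
  surface lies in \<open>LHP v c\<close>, then \<open>v\<close> is a lightlike vector in every normal plane. A Lorentzian
  plane has just the two null directions \<open>e1 + e2\<close> and \<open>e1 - e2\<close>, and a continuously
  moving frame cannot jump from one to the other, nor can the sign of the proportionality factor
  change. So if \<open>v\<close> is the value of the Gauss map at one point, it is its value everywhere
  (\<open>LG_plus_eq_if_normal\<close>). Replacing \<open>e2\<close> by its negative turns \<open>LG_plus\<close> into
  \<open>LG_minus\<close>, so the hyperplane criteria are proved for \<open>LG_plus\<close> alone.

  For the second part, the values of the two Gauss maps at \<open>p\<close> span the normal plane, and a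
  subspace is its own double complement for the scalar product, so the tangent plane at \<open>p\<close> is
  cut out by these two null vectors (\<open>tangent_plane_eq\<close>). If both are constant, then so is the tangent plane, the
  surface lies in the affine plane with this direction, and by the open mapping theorem for
  maps with surjective derivative its image is open there (\<open>image_open_in_plane\<close>). If, on the
  other hand, the image lies in a plane with direction \<open>V\<close>, then all tangent planes equal \<open>V\<close>
  (\<open>tangent_plane_in_affine_plane\<close>), all normal planes coincide, and the first part applies to both null directions.
\<close>

section \<open>The scalar product of signature (2,2)\<close>

text \<open>
  The matrix of the scalar product. It turns orthogonality for \<open>psp\<close> into Euclidean orthogonality,
  for which complements in finite dimension are already understood.
\<close>

definition sign_flip :: "real^4 \<Rightarrow> real^4" where
  "sign_flip x = (\<chi> i. if i = 1 \<or> i = 2 then - x $ i else x $ i)"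

lemma psp_eq_inner: "psp x y = x \<bullet> sign_flip y"
  by (simp add: psp_def sign_flip_def inner_vec_def sum_4)

lemma psp_sign_flip: "psp (sign_flip x) y = x \<bullet> y"
  by (simp add: psp_def sign_flip_def inner_vec_def sum_4)

lemma psp_commute: "psp x y = psp y x"
  by (simp add: psp_def)

lemma bounded_linear_psp: "bounded_linear (\<lambda>x. psp x y)"
  unfolding psp_eq_inner by (rule bounded_linear_inner_left)

lemma psp_linear_left [simp]:
  "psp (x + y) z = psp x z + psp y z" "psp (x - y) z = psp x z - psp y z"
  "psp (- x) z = - psp x z" "psp (c *\<^sub>R x) z = c * psp x z" "psp 0 z = 0"
  by (simp_all add: psp_eq_inner inner_add_left inner_diff_left)

lemma psp_linear_right [simp]:
  "psp z (x + y) = psp z x + psp z y" "psp z (x - y) = psp z x - psp z y"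
  "psp z (- x) = - psp z x" "psp z (c *\<^sub>R x) = c * psp z x" "psp z 0 = 0"
  by (simp_all add: psp_commute[of z])

lemma continuous_on_psp:
  assumes "continuous_on U f"
  shows "continuous_on U (\<lambda>p. psp v (f p))"
  unfolding psp_def by (intro continuous_intros assms)

text \<open>
  Nondegeneracy: \<open>sign_flip\<close> maps the complement for \<open>psp\<close> onto the Euclidean one, and a subspace
  of Euclidean space is the complement of its complement.
\<close>

lemma psp_double_complement:
  assumes "subspace V"
  shows "x \<in> V \<longleftrightarrow> (\<forall>n. (\<forall>t\<in>V. psp n t = 0) \<longrightarrow> psp n x = 0)" (is "_ \<longleftrightarrow> ?R")
proof
  assume R: ?R
  have "orthogonal y x" if "y \<in> V\<^sup>\<bottom>" for y
  proof -
    have "psp (sign_flip y) t = 0" if "t \<in> V" for t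
      using that \<open>y \<in> V\<^sup>\<bottom>\<close>
      by (simp add: psp_sign_flip orthogonal_comp_def orthogonal_def inner_commute)
    then have "psp (sign_flip y) x = 0"
      using R by blast
    then show ?thesis
      by (simp add: psp_sign_flip orthogonal_def)
  qed
  then have "x \<in> V\<^sup>\<bottom>\<^sup>\<bottom>"
    by (simp add: orthogonal_comp_def[of "V\<^sup>\<bottom>"])
  then show "x \<in> V"
    by (simp add: orthogonal_comp_self[OF assms])
qed blast

section \<open>Normalized null vectors\<close>

lemma lightlike_scaleR: "lightlike (a *\<^sub>R x) \<longleftrightarrow> a \<noteq> 0 \<and> lightlike x"
  by (auto simp: lightlike_def)

lemma lightlike_first_coords_pos:
  assumes "lightlike x"
  shows "(x$1)\<^sup>2 + (x$2)\<^sup>2 > 0"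
proof (rule ccontr)
  assume "\<not> (x$1)\<^sup>2 + (x$2)\<^sup>2 > 0"
  then have "(x$1)\<^sup>2 + (x$2)\<^sup>2 = 0"
    by (smt (verit) sum_power2_ge_zero)
  then have "lc_normalize x = 0"
    by (simp add: lc_normalize_def)
  then show False
    using lc_normalize_in_St1_Ss1[OF assms] by (simp add: St1_Ss1_def)
qed

lemma lc_normalize_eq_scaleR:
  assumes "lightlike x"
  obtains r where "r > 0" "lc_normalize x = r *\<^sub>R x"
proof
  show "inverse (sqrt ((x$1)\<^sup>2 + (x$2)\<^sup>2)) > 0"
    using lightlike_first_coords_pos[OF assms] by simp
qed (simp add: lc_normalize_def)

lemma lc_normalize_scaleR:
  assumes "a > 0"
  shows "lc_normalize (a *\<^sub>R x) = lc_normalize x"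
proof -
  have "sqrt (((a *\<^sub>R x)$1)\<^sup>2 + ((a *\<^sub>R x)$2)\<^sup>2) = sqrt (a\<^sup>2 * ((x$1)\<^sup>2 + (x$2)\<^sup>2))"
    by (simp add: power_mult_distrib distrib_left)
  also have "\<dots> = a * sqrt ((x$1)\<^sup>2 + (x$2)\<^sup>2)"
    using assms by (simp add: real_sqrt_mult)
  finally show ?thesis
    using assms unfolding lc_normalize_def by simp
qed

lemma lc_normalize_idem:
  assumes "lightlike x"
  shows "lc_normalize (lc_normalize x) = lc_normalize x"
  by (metis assms lc_normalize_eq_scaleR lc_normalize_scaleR)

lemma continuous_nonzero_stays_positive:
  fixes f :: "'a::topological_space \<Rightarrow> real"
  assumes "connected U" "continuous_on U f" "\<And>p. p \<in> U \<Longrightarrow> f p \<noteq> 0"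
    and "p0 \<in> U" "f p0 > 0" "p \<in> U"
  shows "f p > 0"
proof (rule ccontr)
  assume "\<not> f p > 0"
  moreover have "connected (f ` U)"
    using assms by (intro connected_continuous_image)
  ultimately have "0 \<in> f ` U"
    using assms by (intro connectedD_interval[of "f ` U" "f p" "f p0" 0]) auto
  then show False
    using assms(3) by auto
qed

section \<open>Height functions\<close>

lemma has_derivative_psp:
  assumes "X differentiable (at p)"
  shows "((\<lambda>q. psp (X q) v) has_derivative (\<lambda>w. psp (frechet_derivative X (at p) w) v)) (at p)"
  using bounded_linear.has_derivative[OF bounded_linear_psp]
    assms[unfolded frechet_derivative_works] .

lemma normal_plane_iff:
  "v \<in> normal_plane X p \<longleftrightarrow> (\<forall>w. psp (frechet_derivative X (at p) w) v = 0)"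
  by (auto simp: normal_plane_def tangent_plane_def psp_commute[of v])

lemma const_on_psp_imp_normal:
  assumes "open U" "p \<in> U" "X differentiable (at p)" "\<And>q. q \<in> U \<Longrightarrow> psp (X q) v = c"
  shows "v \<in> normal_plane X p"
proof -
  have "((\<lambda>q. psp (X q) v) has_derivative (\<lambda>w. 0)) (at p)"
    by (rule has_derivative_transform_within_open[OF has_derivative_const assms(1,2)])
      (simp add: assms(4))
  from has_derivative_unique[OF has_derivative_psp[OF assms(3)] this]
  show ?thesis
    by (simp add: normal_plane_iff fun_eq_iff)
qed

lemma psp_const_if_normal:
  assumes "open U" "connected U" "\<And>p. p \<in> U \<Longrightarrow> X differentiable (at p)"
    and "\<And>p. p \<in> U \<Longrightarrow> v \<in> normal_plane X p" "p \<in> U" "q \<in> U"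
  shows "psp (X p) v = psp (X q) v"
proof (rule has_derivative_zero_unique_connected[OF assms(1,2) _ assms(5,6)])
  fix r assume "r \<in> U"
  with has_derivative_psp[OF assms(3)[of r], of v] assms(4)[of r]
  show "((\<lambda>q. psp (X q) v) has_derivative (\<lambda>w. 0)) (at r)"
    by (simp add: normal_plane_iff)
qed

section \<open>Surfaces with an orthonormal frame of the normal bundle\<close>

text \<open>
  These conditions are symmetric under a change of sign of \<open>e2\<close>, which interchanges the two
  Gauss maps; \<open>frame_uminus\<close> below exploits this.
\<close>

locale normal_framed_surface =
  fixes U :: "(real^2) set" and X e1 e2 :: "real^2 \<Rightarrow> real^4"
  assumes open_U: "open U" and connected_U: "connected U" and nonempty_U: "U \<noteq> {}"
    and differentiable_X: "p \<in> U \<Longrightarrow> X differentiable (at p)"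
    and inj_dX: "p \<in> U \<Longrightarrow> inj (frechet_derivative X (at p))"
    and lorentzian_tangent: "p \<in> U \<Longrightarrow> lorentzian_plane (tangent_plane X p)"
    and continuous_e1: "continuous_on U e1" and continuous_e2: "continuous_on U e2"
    and psp_frame: "p \<in> U \<Longrightarrow> psp (e1 p) (e1 p) = -1" "p \<in> U \<Longrightarrow> psp (e2 p) (e2 p) = 1"
      "p \<in> U \<Longrightarrow> psp (e1 p) (e2 p) = 0"
    and span_frame: "p \<in> U \<Longrightarrow> span {e1 p, e2 p} = normal_plane X p"

lemma LG_minus_eq_LG_plus: "LG_minus e1 e2 = LG_plus e1 (\<lambda>p. - e2 p)"
  by (simp add: fun_eq_iff LG_minus_def LG_plus_def)

context normal_framed_surface
begin

lemma frame_uminus: "normal_framed_surface U X e1 (\<lambda>p. - e2 p)"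
proof
  fix p assume p: "p \<in> U"
  have "span {e1 p, - e2 p} = span {e1 p, e2 p}"
    using span_neg[of "- e2 p" "{e1 p, - e2 p}"] unfolding span_eq
    by (auto intro: span_base span_neg)
  then show "span {e1 p, - e2 p} = normal_plane X p"
    using span_frame[OF p] by simp
qed (auto simp: open_U connected_U nonempty_U differentiable_X inj_dX lorentzian_tangent
    continuous_e1 continuous_e2 psp_frame intro!: continuous_on_minus)

lemma psp_frame': "p \<in> U \<Longrightarrow> psp (e2 p) (e1 p) = 0"
  using psp_frame(3) psp_commute by simp

lemma normal_plane_expansion:
  assumes "p \<in> U" "v \<in> normal_plane X p"
  shows "v = (- psp v (e1 p)) *\<^sub>R e1 p + psp v (e2 p) *\<^sub>R e2 p"
proof -
  obtain a b where v: "v = a *\<^sub>R e1 p + b *\<^sub>R e2 p"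
    using assms(2) unfolding span_frame[OF assms(1), symmetric]
    by (auto simp: span_breakdown_eq algebra_simps)
  then have "psp v (e1 p) = - a" "psp v (e2 p) = b"
    using assms(1) by (simp_all add: psp_frame psp_frame')
  with v show ?thesis by simp
qed

lemma frame_in_normal_plane: "p \<in> U \<Longrightarrow> e1 p \<in> normal_plane X p \<and> e2 p \<in> normal_plane X p"
  using span_frame by (metis insertCI span_base)

lemma subspace_normal_plane: "p \<in> U \<Longrightarrow> subspace (normal_plane X p)"
  using span_frame by (metis subspace_span)

lemma lightlike_e1_plus_e2:
  assumes "p \<in> U"
  shows "lightlike (e1 p + e2 p)"
proof -
  have "psp (e1 p + e2 p) (e1 p) = -1" "psp (e1 p + e2 p) (e1 p + e2 p) = 0"
    using assms by (simp_all add: psp_frame psp_frame')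
  then show ?thesis
    unfolding lightlike_def by fastforce
qed

lemma LG_plus_eq_scaleR:
  assumes "p \<in> U"
  obtains r where "r > 0" "LG_plus e1 e2 p = r *\<^sub>R (e1 p + e2 p)"
  using lc_normalize_eq_scaleR[OF lightlike_e1_plus_e2[OF assms]] unfolding LG_plus_def by metis

lemma lightlike_LG_plus:
  assumes "p \<in> U"
  shows "lightlike (LG_plus e1 e2 p)"
proof -
  obtain r where "r > 0" "LG_plus e1 e2 p = r *\<^sub>R (e1 p + e2 p)"
    using LG_plus_eq_scaleR[OF assms] .
  then show ?thesis
    using lightlike_e1_plus_e2[OF assms] by (simp add: lightlike_scaleR del: scaleR_add_right)
qed

lemma LG_plus_in_normal_plane:
  assumes "p \<in> U"
  shows "LG_plus e1 e2 p \<in> normal_plane X p"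
proof -
  obtain r where "LG_plus e1 e2 p = r *\<^sub>R (e1 p + e2 p)"
    using LG_plus_eq_scaleR[OF assms] .
  then show ?thesis
    using frame_in_normal_plane[OF assms] subspace_normal_plane[OF assms]
    by (metis subspace_add subspace_scale)
qed

text \<open>
  Write \<open>v = a e1 + b e2\<close> with continuous coefficients. As \<open>v\<close> is null and nonzero, \<open>a\<^sup>2 = b\<^sup>2\<close>
  and neither coefficient vanishes anywhere. Both are positive at \<open>p0\<close>, hence everywhere by
  connectedness, so \<open>a = b > 0\<close> and \<open>v\<close> is always a positive multiple of \<open>e1 + e2\<close>.
\<close>

lemma LG_plus_eq_if_normal:
  assumes p0: "p0 \<in> U" and normal: "\<And>p. p \<in> U \<Longrightarrow> LG_plus e1 e2 p0 \<in> normal_plane X p"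
    and p: "p \<in> U"
  shows "LG_plus e1 e2 p = LG_plus e1 e2 p0"
proof -
  define v where "v = LG_plus e1 e2 p0"
  have v: "lightlike v"
    unfolding v_def by (rule lightlike_LG_plus[OF p0])
  \<comment> \<open>The coefficient of \<open>e1\<close> carries a minus sign since \<open>\<langle>e1, e1\<rangle> = -1\<close>.\<close>
  define a where "a q = psp v (- e1 q)" for q
  define b where "b q = psp v (e2 q)" for q
  have expand: "v = a q *\<^sub>R e1 q + b q *\<^sub>R e2 q" if "q \<in> U" for q
    using normal_plane_expansion[OF that normal[OF that]] by (simp add: a_def b_def v_def)
  have sq: "(a q)\<^sup>2 = (b q)\<^sup>2" if "q \<in> U" for q
  proof -
    have "psp v v = - (a q)\<^sup>2 + (b q)\<^sup>2"
      unfolding expand[OF that] using that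
      by (simp add: psp_frame psp_frame' power2_eq_square algebra_simps)
    then show ?thesis
      using v by (simp add: lightlike_def)
  qed
  have nz: "a q \<noteq> 0 \<and> b q \<noteq> 0" if "q \<in> U" for q
    using expand[OF that] sq[OF that] v by (auto simp: lightlike_def)
  obtain r where r: "r > 0" "v = r *\<^sub>R (e1 p0 + e2 p0)"
    unfolding v_def using LG_plus_eq_scaleR[OF p0] .
  have at_p0: "a p0 > 0" "b p0 > 0"
    using r p0 by (simp_all add: a_def b_def psp_frame psp_frame')
  have "continuous_on U a" "continuous_on U b"
    unfolding a_def b_def
    by (intro continuous_on_psp continuous_on_minus continuous_e1 continuous_e2)+
  then have pos: "a p > 0" "b p > 0"
    using continuous_nonzero_stays_positive[OF connected_U _ _ p0 _ p] nz at_p0 by metis+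
  then have "a p = b p"
    using sq[OF p] by (simp add: power2_eq_iff)
  then have "v = a p *\<^sub>R (e1 p + e2 p)"
    using expand[OF p] by (simp add: scaleR_add_right)
  then have "lc_normalize v = LG_plus e1 e2 p"
    using pos lc_normalize_scaleR unfolding LG_plus_def by simp
  moreover have "lc_normalize v = v"
    unfolding v_def LG_plus_def by (rule lc_normalize_idem[OF lightlike_e1_plus_e2[OF p0]])
  ultimately show ?thesis
    by (simp add: v_def)
qed

lemma LG_plus_constant_iff_normal:
  assumes "p0 \<in> U"
  shows "LG_plus e1 e2 constant_on U \<longleftrightarrow> (\<forall>p\<in>U. LG_plus e1 e2 p0 \<in> normal_plane X p)"
    (is "?L \<longleftrightarrow> ?R")
proof
  assume ?L
  then have "LG_plus e1 e2 p0 = LG_plus e1 e2 p" if "p \<in> U" for p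
    using that assms by (metis constant_on_def)
  then show ?R
    using LG_plus_in_normal_plane by metis
next
  assume ?R
  then show ?L
    unfolding constant_on_def using LG_plus_eq_if_normal[OF assms] by blast
qed

lemma psp_LG_plus_const:
  assumes "LG_plus e1 e2 constant_on U" "p \<in> U" "q \<in> U"
  shows "psp (X p) (LG_plus e1 e2 q) = psp (X q) (LG_plus e1 e2 q)"
  using psp_const_if_normal[OF open_U connected_U differentiable_X _ assms(2,3)]
    LG_plus_constant_iff_normal[OF assms(3)] assms(1) by blast

text \<open>
  A constant Gauss map is a fixed vector normal to the whole surface, so the height in its direction
  is constant. Both parameters of the hyperplane can then be read off at any single point, which
  gives uniqueness.
\<close>

lemma LG_plus_constant_iff_hyperplane_all:
  "LG_plus e1 e2 constant_on U \<longleftrightarrow>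
     (\<exists>!H. \<exists>v c. lightlike v \<and> H = LHP v c \<and> X ` U \<subseteq> H \<and>
        (\<forall>p\<in>U. v = LG_plus e1 e2 p \<and> psp (X p) v = c))" (is "?L \<longleftrightarrow> (\<exists>!H. ?Q H)")
proof
  obtain p0 where p0: "p0 \<in> U" using nonempty_U by blast
  define v0 where "v0 = LG_plus e1 e2 p0"
  define c0 where "c0 = psp (X p0) v0"
  assume L: ?L
  have v0: "v0 = LG_plus e1 e2 p" if "p \<in> U" for p
    using L that p0 unfolding v0_def constant_on_def by metis
  have c0: "psp (X p) v0 = c0" if "p \<in> U" for p
    using psp_LG_plus_const[OF L that p0] by (simp add: v0_def c0_def)
  show "\<exists>!H. ?Q H"
  proof (rule ex1I)
    have "lightlike v0"
      unfolding v0_def by (rule lightlike_LG_plus[OF p0])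
    moreover have "X ` U \<subseteq> LHP v0 c0"
      using c0 by (auto simp: LHP_def)
    ultimately show "?Q (LHP v0 c0)"
      using v0 c0 by blast
  next
    fix H assume "?Q H"
    then obtain v c where "H = LHP v c" "\<forall>p\<in>U. v = LG_plus e1 e2 p \<and> psp (X p) v = c"
      by (elim exE conjE)
    then show "H = LHP v0 c0"
      using p0 v0_def c0_def by metis
  qed
next
  assume "\<exists>!H. ?Q H"
  then obtain v c where "\<forall>p\<in>U. v = LG_plus e1 e2 p \<and> psp (X p) v = c"
    by (elim ex1E exE conjE)
  then show ?L
    unfolding constant_on_def by metis
qed

text \<open>
  When the Gauss map is constant, its value and the height do not depend on the point, so prescribing
  them at one point is the same as prescribing them at all points. The substantial direction is
  the converse: a hyperplane containing the surface whose normal agrees with the Gauss map at one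
  point makes this normal a section of the normal bundle, and the rigidity of null directions
  (\<open>LG_plus_eq_if_normal\<close>) does the rest.
\<close>

lemma LG_plus_constant_iff_hyperplane_ex:
  "LG_plus e1 e2 constant_on U \<longleftrightarrow>
     (\<exists>!H. \<exists>v c. lightlike v \<and> H = LHP v c \<and> X ` U \<subseteq> H \<and>
        (\<exists>p\<in>U. v = LG_plus e1 e2 p \<and> psp (X p) v = c))" (is "?L \<longleftrightarrow> (\<exists>!H. ?Q H)")
proof
  assume L: ?L
  then have "\<exists>!H. \<exists>v c. lightlike v \<and> H = LHP v c \<and> X ` U \<subseteq> H \<and>
      (\<forall>p\<in>U. v = LG_plus e1 e2 p \<and> psp (X p) v = c)"
    unfolding LG_plus_constant_iff_hyperplane_all .
  moreover have "(\<forall>p\<in>U. v = LG_plus e1 e2 p \<and> psp (X p) v = c) \<longleftrightarrow>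
      (\<exists>p\<in>U. v = LG_plus e1 e2 p \<and> psp (X p) v = c)" for v c
  proof
    assume "\<exists>p\<in>U. v = LG_plus e1 e2 p \<and> psp (X p) v = c"
    then obtain q where q: "q \<in> U" "v = LG_plus e1 e2 q" "psp (X q) v = c"
      by blast
    have "LG_plus e1 e2 p = v" if "p \<in> U" for p
      using L that q unfolding constant_on_def by metis
    moreover have "psp (X p) v = c" if "p \<in> U" for p
      using psp_LG_plus_const[OF L that q(1)] q by simp
    ultimately show "\<forall>p\<in>U. v = LG_plus e1 e2 p \<and> psp (X p) v = c"
      by simp
  qed (use nonempty_U in blast)
  ultimately show "\<exists>!H. ?Q H"
    by simp
next
  assume "\<exists>!H. ?Q H"
  then obtain p0 v c where p0: "p0 \<in> U" "v = LG_plus e1 e2 p0" and H: "X ` U \<subseteq> LHP v c"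
    by (elim ex1E exE conjE bexE) simp
  have "psp (X q) (LG_plus e1 e2 p0) = c" if "q \<in> U" for q
    using H that p0(2) by (auto simp: LHP_def)
  then have "LG_plus e1 e2 p0 \<in> normal_plane X p" if "p \<in> U" for p
    by (rule const_on_psp_imp_normal[OF open_U that differentiable_X[OF that]])
  then show ?L
    by (simp add: LG_plus_constant_iff_normal[OF p0(1)])
qed

section \<open>Planes\<close>

lemma subspace_tangent_plane: "p \<in> U \<Longrightarrow> subspace (tangent_plane X p)"
  using lorentzian_tangent by (simp add: lorentzian_plane_def)

text \<open>
  The tangent plane is the complement of the normal plane, and the two Gauss maps give a null basis
  of the latter.
\<close>

lemma tangent_plane_eq:
  assumes "p \<in> U"
  shows "tangent_plane X p =
    {x. psp x (LG_plus e1 e2 p) = 0 \<and> psp x (LG_minus e1 e2 p) = 0}" (is "_ = ?S")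
proof -
  interpret flip: normal_framed_surface U X e1 "\<lambda>p. - e2 p"
    by (rule frame_uminus)
  obtain r s where rs: "r > 0" "LG_plus e1 e2 p = r *\<^sub>R (e1 p + e2 p)"
    "s > 0" "LG_minus e1 e2 p = s *\<^sub>R (e1 p - e2 p)"
    using LG_plus_eq_scaleR[OF assms] flip.LG_plus_eq_scaleR[OF assms]
    by (metis LG_minus_eq_LG_plus uminus_add_conv_diff add.commute)
  have "x \<in> tangent_plane X p \<longleftrightarrow> (\<forall>n\<in>normal_plane X p. psp n x = 0)" for x
    using psp_double_complement[OF subspace_tangent_plane[OF assms], of x]
    by (auto simp: normal_plane_def)
  also have "(\<forall>n\<in>normal_plane X p. psp n x = 0) \<longleftrightarrow> psp x (e1 p) = 0 \<and> psp x (e2 p) = 0" for x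
  proof
    assume x: "psp x (e1 p) = 0 \<and> psp x (e2 p) = 0"
    show "\<forall>n\<in>normal_plane X p. psp n x = 0"
    proof
      fix n assume n: "n \<in> normal_plane X p"
      have "psp x n = 0"
        by (subst normal_plane_expansion[OF assms n]) (simp add: x)
      then show "psp n x = 0"
        by (simp add: psp_commute)
    qed
  qed (use frame_in_normal_plane[OF assms] psp_commute in metis)
  also have "psp x (e1 p) = 0 \<and> psp x (e2 p) = 0 \<longleftrightarrow> x \<in> ?S" for x
    using rs by auto
  finally show ?thesis
    by blast
qed

text \<open>
  A left inverse \<open>L\<close> of \<open>dX\<close> at one point serves as a linear chart of the plane. In this chart the
  surface is a map from an open set of the Euclidean plane to that plane with invertible
  derivatives, hence an open map.
\<close>

lemma image_open_in_plane:
  assumes p0: "p0 \<in> U" and const: "\<And>p. p \<in> U \<Longrightarrow> tangent_plane X p = V"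
    and in_P: "\<And>p. p \<in> U \<Longrightarrow> X p - X p0 \<in> V"
  shows "openin (top_of_set ((\<lambda>v. X p0 + v) ` V)) (X ` U)"
proof -
  define D where "D = frechet_derivative X"
  have dX: "(X has_derivative D (at p)) (at p)" if "p \<in> U" for p
    using differentiable_X[OF that] unfolding D_def by (simp add: frechet_derivative_works)
  have lin: "linear (D (at p))" if "p \<in> U" for p
    using dX[OF that] has_derivative_linear by blast
  have inj: "inj (D (at p))" if "p \<in> U" for p
    using inj_dX[OF that] by (simp add: D_def)
  have V: "V = range (D (at p))" if "p \<in> U" for p
    using const[OF that] by (simp add: tangent_plane_def D_def)
  obtain L where L: "linear L" "L \<circ> D (at p0) = id"
    using linear_injective_left_inverse[OF lin[OF p0] inj[OF p0]] by blast
  have inj_L: "inj_on L V"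
    unfolding V[OF p0] using L(2) by (auto simp: inj_on_def fun_eq_iff)
  have bl: "bounded_linear L"
    using L(1) by (simp add: linear_conv_bounded_linear)
  have "open ((\<lambda>p. L (X p)) ` U)"
  proof -
    have "L (X p) \<in> interior ((\<lambda>p. L (X p)) ` U)" if p: "p \<in> U" for p
    proof -
      have der: "((\<lambda>q. L (X q)) has_derivative (\<lambda>w. L (D (at q) w))) (at q)" if "q \<in> U" for q
        using bounded_linear.has_derivative[OF bl dX[OF that]] .
      have linc: "linear (\<lambda>w. L (D (at p) w))"
        using der[OF p] has_derivative_linear by blast
      have "inj (\<lambda>w. L (D (at p) w))"
        using inj_L inj[OF p] V[OF p] by (auto simp: inj_on_def)
      then obtain g where g: "linear g" "(\<lambda>w. L (D (at p) w)) \<circ> g = id"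
        using linear_surjective_right_inverse[OF linc] linear_inj_imp_surj[OF linc] by blast
      have "continuous_on U (\<lambda>q. L (X q))"
        using der has_derivative_continuous continuous_at_imp_continuous_on by blast
      then show ?thesis
        using g sussmann_open_mapping[OF open_U _ p der[OF p], of g U] open_U p
        by (simp add: linear_conv_bounded_linear interior_open)
    qed
    then have "(\<lambda>p. L (X p)) ` U \<subseteq> interior ((\<lambda>p. L (X p)) ` U)"
      by blast
    then show ?thesis
      by (metis interior_subset subset_antisym open_interior)
  qed
  then have "open (L -` ((\<lambda>p. L (X p)) ` U))"
    using bl by (intro open_vimage linear_continuous_on)
  moreover have "X ` U = (\<lambda>v. X p0 + v) ` V \<inter> L -` ((\<lambda>p. L (X p)) ` U)"
  proof (intro equalityI subsetI)
    fix x assume "x \<in> X ` U"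
    then show "x \<in> (\<lambda>v. X p0 + v) ` V \<inter> L -` ((\<lambda>p. L (X p)) ` U)"
      using in_P by (force intro: image_eqI[of _ _ "x - X p0"])
  next
    fix x assume "x \<in> (\<lambda>v. X p0 + v) ` V \<inter> L -` ((\<lambda>p. L (X p)) ` U)"
    then obtain v q where v: "v \<in> V" "x = X p0 + v" and q: "q \<in> U" "L x = L (X q)"
      by auto
    have "L v = L (X q - X p0)"
      using q(2) v(2) by (simp add: linear_add[OF L(1)] linear_diff[OF L(1)] algebra_simps)
    then have "v = X q - X p0"
      using inj_L v(1) in_P[OF q(1)] by (simp add: inj_on_def)
    then show "x \<in> X ` U"
      using v q by simp
  qed
  ultimately show ?thesis
    unfolding openin_open by blast
qed

text \<open>
  A vector orthogonal to \<open>V\<close> has constant height along the surface, so it is orthogonal to the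
  tangent planes; these are therefore contained in the double complement \<open>V\<close>, and the dimensions
  agree.
\<close>

lemma tangent_plane_in_affine_plane:
  assumes V: "lorentzian_plane V" and sub: "X ` U \<subseteq> (\<lambda>v. a + v) ` V" and p: "p \<in> U"
  shows "tangent_plane X p = V"
proof -
  have sV: "subspace V" and dim: "dim V = 2"
    using V by (simp_all add: lorentzian_plane_def)
  have "t \<in> V" if t: "t \<in> tangent_plane X p" for t
  proof -
    have "psp n t = 0" if n: "\<forall>t\<in>V. psp n t = 0" for n
    proof -
      have "psp (X q) n = psp a n" if q: "q \<in> U" for q
      proof -
        have "X q \<in> (\<lambda>v. a + v) ` V"
          using sub q by (rule subsetD[OF _ imageI])
        then obtain u where u: "u \<in> V" "X q = a + u"
          by (rule imageE)
        have "psp u n = 0"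
          using n u(1) psp_commute[of n u] by simp
        then show ?thesis
          by (simp add: u(2))
      qed
      then have "n \<in> normal_plane X p"
        by (rule const_on_psp_imp_normal[OF open_U p differentiable_X[OF p]])
      with t show "psp n t = 0"
        by (simp add: normal_plane_def)
    qed
    then show ?thesis
      by (intro psp_double_complement[OF sV, THEN iffD2] allI impI)
  qed
  then show ?thesis
    using lorentzian_tangent[OF p] sV dim
    by (intro subspace_dim_equal) (auto simp: lorentzian_plane_def)
qed

lemma LG_plus_constant_in_affine_plane:
  assumes "lorentzian_plane V" "X ` U \<subseteq> (\<lambda>v. a + v) ` V"
  shows "LG_plus e1 e2 constant_on U"
proof -
  obtain p0 where p0: "p0 \<in> U" using nonempty_U by blast
  have "normal_plane X p = normal_plane X p0" if "p \<in> U" for p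
    using tangent_plane_in_affine_plane[OF assms] that p0 by (simp add: normal_plane_def)
  then show ?thesis
    using LG_plus_constant_iff_normal[OF p0] LG_plus_in_normal_plane[OF p0] by simp
qed

lemma LG_constant_iff_plane:
  "LG_plus e1 e2 constant_on U \<and> LG_minus e1 e2 constant_on U \<longleftrightarrow>
     (\<exists>P. lorentzian_2plane P \<and> openin (top_of_set P) (X ` U))" (is "?L \<longleftrightarrow> ?R")
proof
  interpret flip: normal_framed_surface U X e1 "\<lambda>p. - e2 p"
    by (rule frame_uminus)
  {
    assume L: ?L
    obtain p0 where p0: "p0 \<in> U" using nonempty_U by blast
    define V where "V = tangent_plane X p0"
    have "tangent_plane X p = V" if p: "p \<in> U" for p
    proof -
      have "LG_plus e1 e2 p = LG_plus e1 e2 p0" "LG_minus e1 e2 p = LG_minus e1 e2 p0"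
        using L p p0 by (metis constant_on_def)+
      then show ?thesis
        unfolding V_def tangent_plane_eq[OF p] tangent_plane_eq[OF p0] by simp
    qed
    moreover have "X p - X p0 \<in> V" if p: "p \<in> U" for p
      using psp_LG_plus_const[OF conjunct1[OF L] p p0]
        flip.psp_LG_plus_const[OF conjunct2[OF L, unfolded LG_minus_eq_LG_plus] p p0]
      by (simp add: V_def tangent_plane_eq[OF p0] LG_minus_eq_LG_plus)
    ultimately have "openin (top_of_set ((\<lambda>v. X p0 + v) ` V)) (X ` U)"
      by (rule image_open_in_plane[OF p0])
    then show ?R
      using lorentzian_tangent[OF p0] by (auto simp: lorentzian_2plane_def V_def)
  }
  assume ?R
  then obtain a V where V: "lorentzian_plane V" "X ` U \<subseteq> (\<lambda>v. a + v) ` V"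
    by (metis lorentzian_2plane_def openin_imp_subset)
  show ?L
    using LG_plus_constant_in_affine_plane[OF V] flip.LG_plus_constant_in_affine_plane[OF V]
    by (simp add: LG_minus_eq_LG_plus)
qed

lemma hyperplane_intersection_eq_plane:
  assumes "lorentzian_2plane P" "X ` U \<subseteq> P" "p \<in> U"
  shows "LHP (LG_plus e1 e2 p) (psp (X p) (LG_plus e1 e2 p)) \<inter>
         LHP (LG_minus e1 e2 p) (psp (X p) (LG_minus e1 e2 p)) = P" (is "?I = P")
proof -
  obtain a V where V: "lorentzian_plane V" "P = (\<lambda>v. a + v) ` V"
    using assms(1) by (auto simp: lorentzian_2plane_def)
  have sV: "subspace V"
    using V(1) by (simp add: lorentzian_plane_def)
  obtain u where u: "u \<in> V" "X p = a + u"
    using assms(2,3) V(2) by blast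
  show ?thesis
  proof (rule set_eqI)
    fix x
    have "x \<in> ?I \<longleftrightarrow> x - X p \<in> tangent_plane X p"
      by (simp add: LHP_def tangent_plane_eq[OF assms(3)])
    also have "tangent_plane X p = V"
      using assms(2,3) unfolding V(2) by (rule tangent_plane_in_affine_plane[OF V(1)])
    also have "x - X p \<in> V \<longleftrightarrow> x - a \<in> V"
      using subspace_add[OF sV _ u(1), of "x - X p"] subspace_diff[OF sV _ u(1), of "x - a"] u(2)
      by (auto simp: algebra_simps)
    also have "x - a \<in> V \<longleftrightarrow> x \<in> P"
      unfolding V(2) by (force intro: image_eqI[of _ _ "x - a"])
    finally show "x \<in> ?I \<longleftrightarrow> x \<in> P" .
  qed
qed

end

section \<open>Constant lightcone Gauss maps\<close>

lemma normal_framed_surfaceI: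
  assumes "open U" "connected U" "U \<noteq> {}" "lorentzian_surface U X" "adapted_frame U X e1 e2 e3 e4"
  shows "normal_framed_surface U X e1 e2"
proof
  have Ck: "Ck_on k U X" "Ck_on k U e1" "Ck_on k U e2" for k
    using assms(4,5)
    by (simp_all add: lorentzian_surface_def immersion_on_def adapted_frame_def smooth_on_def)
  show "continuous_on U e1" "continuous_on U e2"
    using Ck(2,3)[of 0] by simp_all
  show "X differentiable (at p)" if "p \<in> U" for p
    using Ck(1)[of "Suc 0"] that by simp
qed (use assms in \<open>auto simp: lorentzian_surface_def immersion_on_def adapted_frame_def\<close>)

theorem theorem1p3:
  fixes U :: "(real^2) set" and X e1 e2 e3 e4 :: "real^2 \<Rightarrow> real^4"
  assumes "open U" and "connected U" and "U \<noteq> {}"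
    and "lorentzian_surface U X"
    and "adapted_frame U X e1 e2 e3 e4"
  shows
    "(LG_plus e1 e2 constant_on U \<longleftrightarrow>
       (\<exists>!H. \<exists>v c. lightlike v \<and> H = LHP v c \<and> X ` U \<subseteq> H \<and>
          (\<forall>p\<in>U. v = LG_plus e1 e2 p \<and> psp (X p) v = c))) \<and>
     (LG_plus e1 e2 constant_on U \<longleftrightarrow>
       (\<exists>!H. \<exists>v c. lightlike v \<and> H = LHP v c \<and> X ` U \<subseteq> H \<and>
          (\<exists>p\<in>U. v = LG_plus e1 e2 p \<and> psp (X p) v = c))) \<and>
     (LG_minus e1 e2 constant_on U \<longleftrightarrow>
       (\<exists>!H. \<exists>v c. lightlike v \<and> H = LHP v c \<and> X ` U \<subseteq> H \<and>
          (\<forall>p\<in>U. v = LG_minus e1 e2 p \<and> psp (X p) v = c))) \<and>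
     (LG_minus e1 e2 constant_on U \<longleftrightarrow>
       (\<exists>!H. \<exists>v c. lightlike v \<and> H = LHP v c \<and> X ` U \<subseteq> H \<and>
          (\<exists>p\<in>U. v = LG_minus e1 e2 p \<and> psp (X p) v = c))) \<and>
     (LG_plus e1 e2 constant_on U \<and> LG_minus e1 e2 constant_on U \<longleftrightarrow>
       (\<exists>P. lorentzian_2plane P \<and> openin (top_of_set P) (X ` U))) \<and>
     (\<forall>P. lorentzian_2plane P \<and> openin (top_of_set P) (X ` U) \<longrightarrow>
       (\<forall>p\<in>U. LHP (LG_plus e1 e2 p) (psp (X p) (LG_plus e1 e2 p)) \<inter>
               LHP (LG_minus e1 e2 p) (psp (X p) (LG_minus e1 e2 p)) = P))"
proof -
  interpret plus: normal_framed_surface U X e1 e2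
    by (rule normal_framed_surfaceI[OF assms])
  interpret minus: normal_framed_surface U X e1 "\<lambda>p. - e2 p"
    by (rule plus.frame_uminus)
  note minus_iff =
    minus.LG_plus_constant_iff_hyperplane_all[folded LG_minus_eq_LG_plus]
    minus.LG_plus_constant_iff_hyperplane_ex[folded LG_minus_eq_LG_plus]
  show ?thesis
  proof (intro conjI plus.LG_plus_constant_iff_hyperplane_all
      plus.LG_plus_constant_iff_hyperplane_ex minus_iff plus.LG_constant_iff_plane allI impI ballI)
    fix P p
    assume P: "lorentzian_2plane P \<and> openin (top_of_set P) (X ` U)" and "p \<in> U"
    then show "LHP (LG_plus e1 e2 p) (psp (X p) (LG_plus e1 e2 p)) \<inter>
        LHP (LG_minus e1 e2 p) (psp (X p) (LG_minus e1 e2 p)) = P"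
      using plus.hyperplane_intersection_eq_plane openin_imp_subset by blast
  qed
qed

end
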